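(* Consider zero initial inventory $x=0$. The following conditions are equivalent. (i) There is $\widehat u\in\mathscr M$ such that the static strategy $\alpha_t=q_t=\widehat u$, $t\ge 0$, is optimal, i.e. attains the supremum defining $v(0)$. (ii) $\mathscr M_\eta\neq\emptyset$ for some $\eta\in\mathbb R$. (iii) $\mathscr M_\zeta\neq\emptyset$. Moreover, if $\mathscr M_\eta\neq\emptyset$ for some $\eta\in\mathbb R$, then $\eta$ is a minimum point of $H$ and $\mathscr M_\eta=\mathscr M$.
   Context: Setting. $\mathbb R_+=[0,\infty)$. $A\subset\mathbb R_+$ is a closed set and $Q\subset\mathbb R_+$ is a compact set, with $0\in A\cap Q$, $A\setminus\{0\}\ne\emptyset$, $Q\setminus\{0\}\neq\emptyset$. The revenue $R:Q\to\mathbb R_+$ is continuous with $R(0)=0$. The production cost $C:A\to\mathbb R_+$ is continuous and non-decreasing; if $A$ is unbounded, then additionally $C(\alpha)/\alpha\to+\infty$ as $A\ni\alpha\to+\infty$. The constant $\beta>0$ is fixed. Admissible strategies and value function. For $x\ge 0$, $\mathscr A(x)$ is the set of pairs of Borel measurable functions $\alpha:\mathbb R_+\to A$, $q:\mathbb R_+\to Q$ (with $\alpha$ locally integrable) such that $X_t=x+\int_0^t(\alpha_s-q_s)\,ds\ge 0$ for all $t\ge 0$. The value function is $$v(x)=\sup_{(\alpha,q)\in\mathscr A(x)}\int_0^\infty e^{-\beta t}(R(q_t)-C(\alpha_t))\,dt,\quad x\ge 0.$$ Hamiltonian. $H(z)=\sup_{q\in Q}\{R(q)-qz\}+\sup_{\alpha\in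 A}\{\alpha z-C(\alpha)\}$ for $z\in\mathbb R$. Its set of minimum points over $\mathbb R$ is a non-empty closed convex subset of $\mathbb R_+$, and $\zeta\ge0$ denotes the least minimum point of $H$. Notation. $$\mathscr M=\arg\max_{u\in Q\cap A}\{R(u)-C(u)\},$$ and for $\eta\in\mathbb R$ $$\mathscr M_R(\eta)=\arg\max_{q\in Q}\{R(q)-\eta q\},\quad \mathscr M_C(\eta)=\arg\max_{\alpha\in A}\{\alpha\eta-C(\alpha)\},\quad \mathscr M_\eta=\mathscr M_R(\eta)\cap\mathscr M_C(\eta).$$ *)

theory Defs
  imports "HOL-Analysis.Analysis"
begin

text \<open>
  Strategies are total functions on the reals, but only their restrictions to the half-line
  of nonnegative times matter; measurability is required on that half-line only.
\<close>

definition inventory :: "real \<Rightarrow> (real \<Rightarrow> real) \<Rightarrow> (real \<Rightarrow> real) \<Rightarrow> real \<Rightarrow> real" where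
  "inventory x \<alpha> q t = x + (LINT s:{0..t}|lborel. \<alpha> s - q s)"

definition admissible ::
  "real set \<Rightarrow> real set \<Rightarrow> real \<Rightarrow> ((real \<Rightarrow> real) \<times> (real \<Rightarrow> real)) set" where
  "admissible A Q x = {(\<alpha>, q).
     \<alpha> \<in> borel_measurable (restrict_space borel {0..}) \<and>
     q \<in> borel_measurable (restrict_space borel {0..}) \<and>
     (\<forall>t\<ge>0. \<alpha> t \<in> A) \<and> (\<forall>t\<ge>0. q t \<in> Q) \<and>
     (\<forall>T\<ge>0. set_integrable lborel {0..T} \<alpha>) \<and>
     (\<forall>t\<ge>0. 0 \<le> inventory x \<alpha> q t)}"

text \<open>
  The Lebesgue integral over \<open>S\<close> as an extended real: the integral of the positive part minus
  the integral of the negative part (\<open>ennreal\<close> truncates negative reals to \<open>0\<close>). The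
  Bochner integral is unsuitable here because it is \<open>0\<close> for non-integrable functions, while a
  production plan may be locally integrable with infinite discounted cost. Its payoff
  then is \<open>- \<infinity>\<close>. For the payoffs below the positive part has a finite integral, because
  \<open>R\<close> is bounded on \<open>Q\<close>, so the case \<open>\<infinity> - \<infinity>\<close> does not occur.
\<close>

definition ext_integral :: "real set \<Rightarrow> (real \<Rightarrow> real) \<Rightarrow> ereal" where
  "ext_integral S f =
     enn2ereal (\<integral>\<^sup>+t\<in>S. ennreal (f t) \<partial>lborel) - enn2ereal (\<integral>\<^sup>+t\<in>S. ennreal (- f t) \<partial>lborel)"

definition payoff ::
  "(real \<Rightarrow> real) \<Rightarrow> (real \<Rightarrow> real) \<Rightarrow> real \<Rightarrow> (real \<Rightarrow> real) \<Rightarrow> (real \<Rightarrow> real) \<Rightarrow> ereal" where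
  "payoff R C \<beta> \<alpha> q = ext_integral {0..} (\<lambda>t. exp (- \<beta> * t) * (R (q t) - C (\<alpha> t)))"

definition value_fun ::
  "real set \<Rightarrow> real set \<Rightarrow> (real \<Rightarrow> real) \<Rightarrow> (real \<Rightarrow> real) \<Rightarrow> real \<Rightarrow> real \<Rightarrow> ereal" where
  "value_fun A Q R C \<beta> x = (SUP (\<alpha>, q) \<in> admissible A Q x. payoff R C \<beta> \<alpha> q)"

definition optimal_strategy ::
  "real set \<Rightarrow> real set \<Rightarrow> (real \<Rightarrow> real) \<Rightarrow> (real \<Rightarrow> real) \<Rightarrow> real \<Rightarrow> real \<Rightarrow>
   (real \<Rightarrow> real) \<Rightarrow> (real \<Rightarrow> real) \<Rightarrow> bool" where
  "optimal_strategy A Q R C \<beta> x \<alpha> q \<longleftrightarrow>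
     (\<alpha>, q) \<in> admissible A Q x \<and> payoff R C \<beta> \<alpha> q = value_fun A Q R C \<beta> x"

text \<open>
  Both suprema are finite under the standing assumptions: \<open>Q\<close> is compact and \<open>A\<close> is either
  compact or \<open>C\<close> grows superlinearly on it.
\<close>

definition hamiltonian ::
  "real set \<Rightarrow> real set \<Rightarrow> (real \<Rightarrow> real) \<Rightarrow> (real \<Rightarrow> real) \<Rightarrow> real \<Rightarrow> real" where
  "hamiltonian A Q R C z = (SUP q\<in>Q. R q - q * z) + (SUP \<alpha>\<in>A. \<alpha> * z - C \<alpha>)"

definition min_points :: "(real \<Rightarrow> real) \<Rightarrow> real set" where
  "min_points f = {z. is_arg_min f (\<lambda>_. True) z}"

text \<open>
  Under the standing assumptions the minimum points form a nonempty closed subset of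
  the nonnegative reals, so the least one exists.
\<close>

definition least_min_point ::
  "real set \<Rightarrow> real set \<Rightarrow> (real \<Rightarrow> real) \<Rightarrow> (real \<Rightarrow> real) \<Rightarrow> real" where
  "least_min_point A Q R C = (LEAST z. z \<in> min_points (hamiltonian A Q R C))"

definition argmax_set :: "(real \<Rightarrow> real) \<Rightarrow> real set \<Rightarrow> real set" where
  "argmax_set f S = {u. is_arg_max f (\<lambda>u. u \<in> S) u}"

definition M_static ::
  "real set \<Rightarrow> real set \<Rightarrow> (real \<Rightarrow> real) \<Rightarrow> (real \<Rightarrow> real) \<Rightarrow> real set" where
  "M_static A Q R C = argmax_set (\<lambda>u. R u - C u) (Q \<inter> A)"

definition M_R :: "real set \<Rightarrow> (real \<Rightarrow> real) \<Rightarrow> real \<Rightarrow> real set" where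
  "M_R Q R \<eta> = argmax_set (\<lambda>q. R q - \<eta> * q) Q"

definition M_C :: "real set \<Rightarrow> (real \<Rightarrow> real) \<Rightarrow> real \<Rightarrow> real set" where
  "M_C A C \<eta> = argmax_set (\<lambda>\<alpha>. \<alpha> * \<eta> - C \<alpha>) A"

definition M_eta ::
  "real set \<Rightarrow> real set \<Rightarrow> (real \<Rightarrow> real) \<Rightarrow> (real \<Rightarrow> real) \<Rightarrow> real \<Rightarrow> real set" where
  "M_eta A Q R C \<eta> = M_R Q R \<eta> \<inter> M_C A C \<eta>"

end

theory Submission
  imports Defs
begin

text \<open>
  The theorem is a statement of strong duality. The multiplier \<open>\<eta>\<close> prices a unit of inventory,
  and \<open>H \<eta>\<close> is the largest instantaneous profit \<open>R q - C \<alpha> + \<eta> (\<alpha> - q)\<close> when the good can be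
  bought and sold freely at that price. Static strategies have \<open>\<alpha> = q\<close>, so their profit
  \<open>R u - C u\<close> is at most \<open>H z\<close> for every \<open>z\<close>, and \<open>M\<^sub>\<eta>\<close> consists exactly of those \<open>u\<close> for which
  this inequality is an equality at \<open>z = \<eta>\<close> (lemma \<open>M_eta_iff\<close>). Hence if \<open>M\<^sub>\<eta>\<close> is nonempty, then
  \<open>\<eta>\<close> minimizes \<open>H\<close>, the minimum of \<open>H\<close> is the best static profit, and \<open>M\<^sub>z = M\<close> for every
  minimum point \<open>z\<close>, in particular for the least one.
  
  The same price bounds dynamic strategies. The discounted integral of the net flow \<open>\<alpha> - q\<close> is
  nonnegative when inventory starts at \<open>0\<close> and stays nonnegative, because discounting gives more
  weight to the earlier production of a unit than to its later sale. As minimum points of \<open>H\<close>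
  are nonnegative, no payoff exceeds \<open>H \<eta> / \<beta>\<close> (lemma \<open>payoff_le_hamiltonian\<close>), and an element of
  \<open>M\<^sub>\<eta>\<close> attains this value.
  
  Conversely, let a static strategy \<open>u\<close> be optimal. Compare it with the strategy that first
  builds up inventory with one pair of rates, then sells it off with another pair, and then
  follows \<open>u\<close>. When the two phases become short, discounting inside them is negligible, and
  optimality says that no convex combination of two points \<open>(\<alpha> - q, R q - C \<alpha>)\<close> lies above
  \<open>(0, R u - C u)\<close> on the vertical axis (lemma \<open>mixture_le_optimal_static_profit\<close>). A line
  through \<open>(0, R u - C u)\<close> that lies above all these points therefore exists (lemma
  \<open>exists_supporting_slope\<close>), and minus its slope is a multiplier \<open>\<eta>\<close> with \<open>u \<in> M\<^sub>\<eta>\<close>.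
\<close>

section \<open>Extended integrals\<close>

lemma ext_integral_set_integrable:
  assumes "set_integrable lborel S f"
  shows "ext_integral S f = ereal (LINT t:S|lborel. f t)"
proof -
  let ?g = "\<lambda>t. indicator S t *\<^sub>R f t"
  have int: "integrable lborel ?g"
    using assms by (simp add: set_integrable_def)
  have pos: "(\<integral>\<^sup>+t\<in>S. ennreal (f t) \<partial>lborel) = (\<integral>\<^sup>+t. ennreal (?g t) \<partial>lborel)"
    by (intro nn_integral_cong) (auto simp: indicator_def)
  have neg: "(\<integral>\<^sup>+t\<in>S. ennreal (- f t) \<partial>lborel) = (\<integral>\<^sup>+t. ennreal (- ?g t) \<partial>lborel)"
    by (intro nn_integral_cong) (auto simp: indicator_def)
  obtain r q where rq: "0 \<le> r" "0 \<le> q"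
    "(\<integral>\<^sup>+t. ennreal (?g t) \<partial>lborel) = ennreal r"
    "(\<integral>\<^sup>+t. ennreal (- ?g t) \<partial>lborel) = ennreal q"
    "integral\<^sup>L lborel ?g = r - q"
    using integrableE[OF int] by blast
  then show ?thesis
    by (simp add: ext_integral_def pos neg set_lebesgue_integral_def enn2ereal_ennreal)
qed

text \<open>
  If the negative part of \<open>f\<close> has infinite integral, then the extended integral is \<open>- \<infinity>\<close>, since the
  positive part is controlled by \<open>g\<close>. Only integrable \<open>f\<close> need to be examined.
\<close>

lemma ext_integral_le:
  assumes meas: "set_borel_measurable lborel S f"
    and g: "set_integrable lborel S g" and fg: "\<And>t. t \<in> S \<Longrightarrow> f t \<le> g t"
    and le: "set_integrable lborel S f \<Longrightarrow> (LINT t:S|lborel. f t) \<le> b"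
  shows "ext_integral S f \<le> ereal b"
proof -
  let ?f = "\<lambda>t. indicator S t *\<^sub>R f t" and ?g = "\<lambda>t. indicator S t *\<^sub>R g t"
  have pos: "(\<integral>\<^sup>+t\<in>S. ennreal (f t) \<partial>lborel) = (\<integral>\<^sup>+t. ennreal (?f t) \<partial>lborel)"
    by (intro nn_integral_cong) (auto simp: indicator_def)
  have neg: "(\<integral>\<^sup>+t\<in>S. ennreal (- f t) \<partial>lborel) = (\<integral>\<^sup>+t. ennreal (- ?f t) \<partial>lborel)"
    by (intro nn_integral_cong) (auto simp: indicator_def)
  have "(\<integral>\<^sup>+t. ennreal (?f t) \<partial>lborel) \<le> (\<integral>\<^sup>+t. ennreal (?g t) \<partial>lborel)"
    using fg by (intro nn_integral_mono) (auto simp: indicator_def ennreal_leI)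
  also have "\<dots> < \<infinity>"
    using g by (simp add: set_integrable_def real_integrable_def less_top)
  finally have fin: "(\<integral>\<^sup>+t. ennreal (?f t) \<partial>lborel) \<noteq> \<infinity>" by simp
  show ?thesis
  proof (cases "(\<integral>\<^sup>+t. ennreal (- ?f t) \<partial>lborel) = \<infinity>")
    case True
    obtain r where "0 \<le> r" "(\<integral>\<^sup>+t. ennreal (?f t) \<partial>lborel) = ennreal r"
      using fin by (cases "\<integral>\<^sup>+t. ennreal (?f t) \<partial>lborel") auto
    with True show ?thesis
      by (simp add: ext_integral_def pos neg enn2ereal_ennreal)
  next
    case False
    with fin meas have "set_integrable lborel S f"
      by (simp add: set_integrable_def real_integrable_def set_borel_measurable_def)
    with le show ?thesis by (simp add: ext_integral_set_integrable)
  qed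
qed

section \<open>Discounting\<close>

lemma set_integrable_const_Icc: "set_integrable lborel {0..T} (\<lambda>_. c)"
  for T c :: real
  by (intro borel_integrable_compact[unfolded set_integrable_def[symmetric]]) auto

lemma
  fixes \<beta> :: real
  assumes "0 < \<beta>"
  shows set_integrable_discount: "set_integrable lborel {s..} (\<lambda>t. exp (- \<beta> * t))"
    and set_integral_discount: "(LINT t:{s..}|lborel. exp (- \<beta> * t)) = exp (- \<beta> * s) / \<beta>"
proof -
  have hi: "((\<lambda>t. exp (- \<beta> * t)) has_integral exp (- \<beta> * s) / \<beta>) {s..}"
    using has_integral_exp_minus_to_infinity[OF assms] .
  then have "(\<lambda>t. exp (- \<beta> * t)) absolutely_integrable_on {s..}"
    by (intro nonnegative_absolutely_integrable_1) (auto simp: integrable_on_def)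
  moreover have "(\<lambda>t. indicator {s..} t *\<^sub>R exp (- \<beta> * t)) \<in> borel_measurable lborel"
    by measurable
  ultimately show int: "set_integrable lborel {s..} (\<lambda>t. exp (- \<beta> * t))"
    by (simp add: set_integrable_def integrable_completion)
  show "(LINT t:{s..}|lborel. exp (- \<beta> * t)) = exp (- \<beta> * s) / \<beta>"
    using set_borel_integral_eq_integral(2)[OF int] integral_unique[OF hi] by simp
qed

text \<open>
  Integrands of piecewise constant strategies are combinations of \<open>indicator {s..}\<close> with the
  switching times \<open>s\<close>.
\<close>

lemma
  fixes \<beta> :: real
  assumes "0 < \<beta>" and "0 \<le> s"
  shows set_integrable_delayed_discount:
      "set_integrable lborel {0..} (\<lambda>t. exp (- \<beta> * t) * indicator {s..} t)"
    and set_integral_delayed_discount: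
      "(LINT t:{0..}|lborel. exp (- \<beta> * t) * indicator {s..} t) = exp (- \<beta> * s) / \<beta>"
proof -
  have eq: "indicator {0..} t *\<^sub>R (exp (- \<beta> * t) * indicator {s..} t) =
      indicator {s..} t *\<^sub>R exp (- \<beta> * t)" for t
    using assms(2) by (auto simp: indicator_def)
  show "set_integrable lborel {0..} (\<lambda>t. exp (- \<beta> * t) * indicator {s..} t)"
    using set_integrable_discount[OF assms(1)] unfolding set_integrable_def eq .
  show "(LINT t:{0..}|lborel. exp (- \<beta> * t) * indicator {s..} t) = exp (- \<beta> * s) / \<beta>"
    using set_integral_discount[OF assms(1)] unfolding set_lebesgue_integral_def eq .
qed

text \<open>
  By the second mean value theorem for integrals, the discounted integral of \<open>f\<close> equals
  \<open>F c + e (F T - F c)\<close>, where \<open>F\<close> is the cumulative flow, \<open>e = exp (- \<beta> T)\<close> and \<open>c\<close> is some time in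
  \<open>{0..T}\<close>. This is a convex combination of \<open>F c\<close> and \<open>F T\<close>, both bounded below by \<open>- x\<close>. The mean
  value theorem replaces an integration by parts, for which \<open>F\<close> lacks pointwise derivatives.
\<close>

lemma discounted_flow_ge:
  fixes f :: "real \<Rightarrow> real"
  assumes "0 \<le> \<beta>" and "0 \<le> T" and int: "f integrable_on {0..T}"
    and ge: "\<And>t. 0 \<le> t \<Longrightarrow> t \<le> T \<Longrightarrow> - x \<le> integral {0..t} f"
  shows "- x \<le> integral {0..T} (\<lambda>t. exp (- \<beta> * t) * f t)"
proof -
  \<comment> \<open>The mean value theorem asks for a nondecreasing weight, hence the sign.\<close>
  obtain c where c: "c \<in> {0..T}" and
    eq: "integral {0..T} (\<lambda>t. - exp (- \<beta> * t) * f t) =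
      - exp (- \<beta> * 0) * integral {0..c} f + (- exp (- \<beta> * T)) * integral {c..T} f"
    by (rule second_mean_value_theorem[OF int \<open>0 \<le> T\<close>, of "\<lambda>t. - exp (- \<beta> * t)"])
       (use \<open>0 \<le> \<beta>\<close> in \<open>auto intro: mult_left_mono\<close>)
  let ?e = "exp (- \<beta> * T)"
  have comb: "integral {0..c} f + integral {c..T} f = integral {0..T} f"
    using c by (intro Henstock_Kurzweil_Integration.integral_combine int) auto
  have tail: "integral {c..T} f = integral {0..T} f - integral {0..c} f"
    using comb by simp
  have "integral {0..T} (\<lambda>t. exp (- \<beta> * t) * f t) =
      integral {0..c} f + ?e * integral {c..T} f"
    using eq by simp
  also have "\<dots> = (1 - ?e) * integral {0..c} f + ?e * integral {0..T} f"
    by (simp only: tail) (simp add: algebra_simps)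
  also have "\<dots> \<ge> (1 - ?e) * (- x) + ?e * (- x)"
    using c \<open>0 \<le> \<beta>\<close> \<open>0 \<le> T\<close> by (intro add_mono mult_left_mono ge) auto
  finally show ?thesis by (simp add: algebra_simps)
qed

section \<open>A supporting line in the plane\<close>

text \<open>
  The slope \<open>- \<eta>\<close> of a line through \<open>(0, c)\<close> that stays above \<open>D\<close> has to satisfy
  \<open>(p - c) / d \<le> - \<eta>\<close> for the points with \<open>d > 0\<close> and the reverse inequality for the points with
  \<open>d < 0\<close>. The condition on mixtures says that each bound of one kind is compatible with each
  bound of the other kind, so the extreme bound from the points on the left works.
\<close>

lemma exists_supporting_slope:
  fixes D :: "(real \<times> real) set"
  assumes D_pos: "(d\<^sub>0, p\<^sub>0) \<in> D" "0 < d\<^sub>0" and D_neg: "(e\<^sub>0, r\<^sub>0) \<in> D" "e\<^sub>0 < 0"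
    and mix: "\<And>d p e r. (d, p) \<in> D \<Longrightarrow> 0 < d \<Longrightarrow> (e, r) \<in> D \<Longrightarrow> e < 0 \<Longrightarrow>
                p * (- e) + r * d \<le> c * (d - e)"
    and zero: "\<And>p. (0, p) \<in> D \<Longrightarrow> p \<le> c"
  obtains \<eta> where "\<And>d p. (d, p) \<in> D \<Longrightarrow> p + \<eta> * d \<le> c"
proof -
  let ?N = "{y \<in> D. fst y < 0}" and ?slope = "\<lambda>y. (snd y - c) / (- fst y)"
  have slope_le: "?slope y \<le> (c - p) / d" if "y \<in> ?N" "(d, p) \<in> D" "0 < d" for y d p
    using mix[of d p "fst y" "snd y"] that by (simp add: field_simps)
  then have bdd: "bdd_above (?slope ` ?N)"
    using D_pos by (meson bdd_above.I2)
  have "p + Sup (?slope ` ?N) * d \<le> c" if dp: "(d, p) \<in> D" for d p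
  proof (cases d "0 :: real" rule: linorder_cases)
    case less
    then have "?slope (d, p) \<le> Sup (?slope ` ?N)"
      using dp by (intro cSUP_upper bdd) auto
    with less show ?thesis by (simp add: field_simps)
  next
    case equal
    with zero dp show ?thesis by simp
  next
    case greater
    have "Sup (?slope ` ?N) \<le> (c - p) / d"
      using D_neg by (intro cSUP_least slope_le[OF _ dp greater]) auto
    with greater show ?thesis by (simp add: field_simps)
  qed
  then show ?thesis using that by blast
qed

section \<open>The Hamiltonian and static strategies\<close>

locale production_model =
  fixes A Q :: "real set" and R C :: "real \<Rightarrow> real"
  assumes A_nonneg: "A \<subseteq> {0..}" and closed_A: "closed A"
    and zero_in_A: "0 \<in> A" and A_nontrivial: "A - {0} \<noteq> {}"
    and Q_nonneg: "Q \<subseteq> {0..}" and compact_Q: "compact Q"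
    and zero_in_Q: "0 \<in> Q" and Q_nontrivial: "Q - {0} \<noteq> {}"
    and cont_R: "continuous_on Q R" and R_nonneg: "\<forall>q\<in>Q. 0 \<le> R q" and R_zero: "R 0 = 0"
    and cont_C: "continuous_on A C" and C_nonneg: "\<forall>\<alpha>\<in>A. 0 \<le> C \<alpha>" and mono_C: "mono_on A C"
    and superlinear_C:
      "\<not> bounded A \<Longrightarrow> filterlim (\<lambda>\<alpha>. C \<alpha> / \<alpha>) at_top (inf at_top (principal A))"
begin

abbreviation "H \<equiv> hamiltonian A Q R C"

text \<open>
  For unbounded \<open>A\<close> the superlinear cost exceeds \<open>\<alpha> z\<close> for all large \<open>\<alpha>\<close>, and the remaining \<open>\<alpha>\<close>
  are bounded.
\<close>

lemma bdd_above_production: "bdd_above ((\<lambda>\<alpha>. \<alpha> * z - C \<alpha>) ` A)"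
proof (cases "bounded A")
  case True
  then have "compact A"
    using closed_A by (simp add: compact_eq_bounded_closed)
  then have "compact ((\<lambda>\<alpha>. \<alpha> * z - C \<alpha>) ` A)"
    by (intro compact_continuous_image continuous_intros cont_C)
  then show ?thesis
    by (intro bounded_imp_bdd_above compact_imp_bounded)
next
  case False
  then have "\<forall>\<^sub>F \<alpha> in inf at_top (principal A). z \<le> C \<alpha> / \<alpha>"
    using superlinear_C by (simp add: filterlim_at_top)
  then obtain K where K: "\<And>\<alpha>. K \<le> \<alpha> \<Longrightarrow> \<alpha> \<in> A \<Longrightarrow> z \<le> C \<alpha> / \<alpha>"
    by (auto simp: eventually_inf_principal eventually_at_top_linorder)
  have "\<alpha> * z - C \<alpha> \<le> max K 0 * \<bar>z\<bar>" if "\<alpha> \<in> A" for \<alpha>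
  proof (cases "K \<le> \<alpha> \<and> 0 < \<alpha>")
    case True
    then have "\<alpha> * z \<le> C \<alpha>"
      using K[of \<alpha>] that by (simp add: field_simps)
    moreover have "0 \<le> max K 0 * \<bar>z\<bar>" by simp
    ultimately show ?thesis by linarith
  next
    case False
    moreover have "0 \<le> \<alpha>" using that A_nonneg by auto
    ultimately have "\<alpha> * \<bar>z\<bar> \<le> max K 0 * \<bar>z\<bar>"
      by (intro mult_right_mono) auto
    moreover have "\<alpha> * z \<le> \<alpha> * \<bar>z\<bar>"
      using \<open>0 \<le> \<alpha>\<close> by (intro mult_left_mono) auto
    ultimately show ?thesis using C_nonneg that by fastforce
  qed
  then show ?thesis by (rule bdd_above.I2)
qed

lemma bdd_above_sales: "bdd_above ((\<lambda>q. R q - q * z) ` Q)"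
proof -
  have "compact ((\<lambda>q. R q - q * z) ` Q)"
    using compact_Q cont_R by (intro compact_continuous_image continuous_intros)
  then show ?thesis
    by (intro bounded_imp_bdd_above compact_imp_bounded)
qed

lemma hamiltonian_ge:
  assumes "q \<in> Q" "\<alpha> \<in> A"
  shows "R q - q * z + (\<alpha> * z - C \<alpha>) \<le> H z"
  unfolding hamiltonian_def
  using assms by (intro add_mono cSUP_upper bdd_above_sales bdd_above_production)

text \<open>
  The two suprema are independent, so \<open>H z\<close> is a joint supremum over pairs of rates. In this form
  \<open>H\<close> is a supremum of affine functions of \<open>z\<close>, so its sublevel sets are intersections of closed
  sets, and it can be compared with static profits, which belong to the pairs with equal rates.
\<close>

lemma hamiltonian_le_iff:
  "H z \<le> m \<longleftrightarrow> (\<forall>q\<in>Q. \<forall>\<alpha>\<in>A. R q - q * z + (\<alpha> * z - C \<alpha>) \<le> m)"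
proof
  assume "H z \<le> m"
  then show "\<forall>q\<in>Q. \<forall>\<alpha>\<in>A. R q - q * z + (\<alpha> * z - C \<alpha>) \<le> m"
    using hamiltonian_ge order_trans by blast
next
  assume le: "\<forall>q\<in>Q. \<forall>\<alpha>\<in>A. R q - q * z + (\<alpha> * z - C \<alpha>) \<le> m"
  have "(SUP q\<in>Q. R q - q * z) \<le> m - (SUP \<alpha>\<in>A. \<alpha> * z - C \<alpha>)"
  proof (rule cSUP_least)
    fix q assume "q \<in> Q"
    then have "(SUP \<alpha>\<in>A. \<alpha> * z - C \<alpha>) \<le> m - (R q - q * z)"
      using le zero_in_A by (intro cSUP_least) (auto simp: algebra_simps)
    then show "R q - q * z \<le> m - (SUP \<alpha>\<in>A. \<alpha> * z - C \<alpha>)" by simp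
  qed (use zero_in_Q in auto)
  then show "H z \<le> m" by (simp add: hamiltonian_def)
qed

lemma static_profit_le_hamiltonian: "u \<in> Q \<inter> A \<Longrightarrow> R u - C u \<le> H z"
  using hamiltonian_ge[of u u z] by simp

text \<open>
  Complementary slackness: the profit \<open>R u - C u\<close> is the sum of the two objectives at \<open>u\<close>, the
  price terms \<open>\<eta> u\<close> cancelling. It reaches the sum \<open>H \<eta>\<close> of the two suprema exactly when each
  objective is maximal at \<open>u\<close>.
\<close>

lemma M_eta_iff: "u \<in> M_eta A Q R C \<eta> \<longleftrightarrow> u \<in> Q \<inter> A \<and> H \<eta> \<le> R u - C u"
proof -
  have "(\<forall>q\<in>Q. R q - \<eta> * q \<le> R u - \<eta> * u) \<and> (\<forall>\<alpha>\<in>A. \<alpha> * \<eta> - C \<alpha> \<le> u * \<eta> - C u)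
      \<longleftrightarrow> H \<eta> \<le> R u - C u" (is "?max \<longleftrightarrow> _") if u: "u \<in> Q" "u \<in> A"
  proof
    assume m: ?max
    have "R q - q * \<eta> + (\<alpha> * \<eta> - C \<alpha>) \<le> R u - C u" if "q \<in> Q" "\<alpha> \<in> A" for q \<alpha>
    proof -
      have "R q - \<eta> * q \<le> R u - \<eta> * u" "\<alpha> * \<eta> - C \<alpha> \<le> u * \<eta> - C u"
        using m that by auto
      then show ?thesis by (simp add: algebra_simps)
    qed
    then show "H \<eta> \<le> R u - C u" by (simp add: hamiltonian_le_iff)
  next
    assume le: "H \<eta> \<le> R u - C u"
    then show ?max
      using hamiltonian_ge[of _ u \<eta>] hamiltonian_ge[of u _ \<eta>] u by (fastforce simp: mult.commute)
  qed
  then show ?thesis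
    by (auto simp: M_eta_def M_R_def M_C_def argmax_set_def is_arg_max_linorder)
qed

lemma min_points_iff: "z \<in> min_points H \<longleftrightarrow> (\<forall>y. H z \<le> H y)"
  by (simp add: min_points_def is_arg_min_linorder)

lemma M_eta_imp_min_point:
  assumes "M_eta A Q R C \<eta> \<noteq> {}"
  shows "\<eta> \<in> min_points H"
proof -
  obtain u where "u \<in> Q \<inter> A" "H \<eta> \<le> R u - C u"
    using assms M_eta_iff by blast
  then have "H \<eta> \<le> H y" for y
    using static_profit_le_hamiltonian[of u y] by linarith
  then show ?thesis by (simp add: min_points_iff)
qed

lemma M_eta_eq_M_static:
  assumes "M_eta A Q R C \<eta> \<noteq> {}"
  shows "M_eta A Q R C \<eta> = M_static A Q R C"
proof -
  obtain u where u: "u \<in> Q \<inter> A" "H \<eta> \<le> R u - C u"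
    using assms M_eta_iff by blast
  have "w \<in> M_eta A Q R C \<eta> \<longleftrightarrow> w \<in> M_static A Q R C" for w
  proof -
    have "w \<in> M_static A Q R C \<longleftrightarrow> w \<in> Q \<inter> A \<and> (\<forall>v\<in>Q \<inter> A. R v - C v \<le> R w - C w)"
      by (auto simp: M_static_def argmax_set_def is_arg_max_linorder)
    also have "\<dots> \<longleftrightarrow> w \<in> Q \<inter> A \<and> H \<eta> \<le> R w - C w"
      using u static_profit_le_hamiltonian[of _ \<eta>] by (blast intro: order_trans)
    finally show ?thesis by (simp add: M_eta_iff)
  qed
  then show ?thesis by blast
qed

text \<open>
  The set of minimum points is a sublevel set of \<open>H\<close>, hence closed. It is bounded below because
  \<open>H z\<close> dominates \<open>R q - q z - C 0\<close> with some \<open>q > 0\<close>, which is large for very negative \<open>z\<close>. So the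
  infimum of the set belongs to it.
\<close>

lemma least_min_point_mem:
  assumes "\<eta> \<in> min_points H"
  shows "least_min_point A Q R C \<in> min_points H"
proof -
  let ?Z = "min_points H"
  have mem: "z \<in> ?Z \<longleftrightarrow> H z \<le> H \<eta>" for z
    using assms by (auto simp: min_points_iff intro: order_trans)
  have "?Z = (\<Inter>q\<in>Q. \<Inter>\<alpha>\<in>A. {z. R q - q * z + (\<alpha> * z - C \<alpha>) \<le> H \<eta>})"
    by (auto simp: mem hamiltonian_le_iff)
  then have closed: "closed ?Z"
    by (auto intro!: closed_INT closed_Collect_le continuous_intros)
  obtain q where q: "q \<in> Q" "0 < q"
    using Q_nontrivial Q_nonneg by force
  have "(R q - C 0 - H \<eta>) / q \<le> z" if "z \<in> ?Z" for z
  proof -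
    have "R q - q * z - C 0 \<le> H \<eta>"
      using hamiltonian_ge[OF q(1) zero_in_A, of z] that mem[of z] by simp
    then show ?thesis using q(2) by (simp add: field_simps)
  qed
  then have bdd: "bdd_below ?Z" by (rule bdd_below.I)
  have "Inf ?Z \<in> ?Z"
    using assms bdd closed by (intro closed_contains_Inf) auto
  moreover have "least_min_point A Q R C = Inf ?Z"
    unfolding least_min_point_def
    by (rule Least_equality) (auto intro: \<open>Inf ?Z \<in> ?Z\<close> cInf_lower bdd)
  ultimately show ?thesis by simp
qed

lemma M_eta_at_least_min_point:
  assumes "M_eta A Q R C \<eta> \<noteq> {}"
  shows "M_eta A Q R C (least_min_point A Q R C) \<noteq> {}"
proof -
  obtain u where "u \<in> Q \<inter> A" "H \<eta> \<le> R u - C u"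
    using assms M_eta_iff by blast
  moreover have "H (least_min_point A Q R C) \<le> H \<eta>"
    using least_min_point_mem[OF M_eta_imp_min_point[OF assms]] by (simp add: min_points_iff)
  ultimately have "u \<in> M_eta A Q R C (least_min_point A Q R C)"
    by (simp add: M_eta_iff)
  then show ?thesis by blast
qed

text \<open>
  At a price \<open>z \<le> 0\<close> it is best to produce nothing, because \<open>C\<close> is nondecreasing. The value \<open>H 0\<close> is
  then attained by a revenue maximizer \<open>q\<close>, which can be chosen positive. With this \<open>q\<close>, moving
  the price from \<open>0\<close> to \<open>z < 0\<close> adds \<open>- q z > 0\<close>, so \<open>H z > H 0\<close>.
\<close>

lemma min_point_nonneg:
  assumes "z \<in> min_points H"
  shows "0 \<le> z"
proof (rule ccontr)
  assume "\<not> 0 \<le> z"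
  obtain s where s: "s \<in> Q" "\<forall>q\<in>Q. R q \<le> R s"
    using continuous_attains_sup[OF compact_Q _ cont_R] zero_in_Q by blast
  obtain r where r: "r \<in> Q" "0 < r"
    using Q_nontrivial Q_nonneg by force
  obtain q where q: "q \<in> Q" "0 < q" and q_max: "\<forall>p\<in>Q. R p \<le> R q"
    \<comment> \<open>If \<open>0\<close> maximizes the nonnegative revenue, then \<open>R\<close> vanishes on \<open>Q\<close>.\<close>
  proof (cases "s = 0")
    case True
    with s R_zero R_nonneg r have "\<forall>p\<in>Q. R p \<le> R r" by force
    with r that show ?thesis by blast
  next
    case False
    with s Q_nonneg that show ?thesis by force
  qed
  have "R p - C \<alpha> \<le> R q - C 0" if "p \<in> Q" "\<alpha> \<in> A" for p \<alpha>
  proof -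
    have "C 0 \<le> C \<alpha>"
      using that zero_in_A A_nonneg by (intro mono_onD[OF mono_C]) auto
    then show ?thesis using q_max that by force
  qed
  then have "H 0 \<le> R q - C 0" by (simp add: hamiltonian_le_iff)
  also have "\<dots> < R q - q * z - C 0"
    using q(2) \<open>\<not> 0 \<le> z\<close> by (simp add: mult_pos_neg)
  also have "\<dots> \<le> H z"
    using hamiltonian_ge[OF q(1) zero_in_A, of z] by simp
  finally show False using assms by (simp add: min_points_iff leD)
qed

end

section \<open>Upper bound for payoffs by duality\<close>

locale discounted_production_model = production_model +
  fixes \<beta> :: real
  assumes \<beta>_pos: "0 < \<beta>"
begin

lemma set_borel_measurable_profit:
  assumes "(\<alpha>, q) \<in> admissible A Q x"
  shows "set_borel_measurable lborel {0..} (\<lambda>t. exp (- \<beta> * t) * (R (q t) - C (\<alpha> t)))"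
proof -
  have \<alpha>: "\<alpha> \<in> measurable (restrict_space borel {0..}) (restrict_space borel A)"
    and q: "q \<in> measurable (restrict_space borel {0..}) (restrict_space borel Q)"
    using assms by (auto simp: admissible_def space_restrict_space intro!: measurable_restrict_space2)
  have [measurable]: "(\<lambda>t. C (\<alpha> t)) \<in> borel_measurable (restrict_space borel {0..})"
    using measurable_compose[OF \<alpha> borel_measurable_continuous_on_restrict[OF cont_C]] .
  have [measurable]: "(\<lambda>t. R (q t)) \<in> borel_measurable (restrict_space borel {0..})"
    using measurable_compose[OF q borel_measurable_continuous_on_restrict[OF cont_R]] .
  have [measurable]: "(\<lambda>t. exp (- \<beta> * t)) \<in> borel_measurable (restrict_space borel {0..})"
    by (intro measurable_restrict_space1) measurable
  have "(\<lambda>t. exp (- \<beta> * t) * (R (q t) - C (\<alpha> t)))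
      \<in> borel_measurable (restrict_space borel {0..})"
    by measurable
  then show ?thesis
    by (simp add: set_borel_measurable_def borel_measurable_restrict_space_iff)
qed

lemma set_integrable_sales:
  assumes "(\<alpha>, q) \<in> admissible A Q x" and "0 \<le> T"
  shows "set_integrable lborel {0..T} q"
proof -
  obtain K where K: "\<And>y. y \<in> Q \<Longrightarrow> \<bar>y\<bar> \<le> K"
    using compact_imp_bounded[OF compact_Q] unfolding bounded_iff by auto
  have "(\<lambda>t. indicator {0..} t *\<^sub>R q t) \<in> borel_measurable borel"
    using assms by (simp add: admissible_def borel_measurable_restrict_space_iff)
  then have "(\<lambda>t. indicator {0..T} t *\<^sub>R (indicator {0..} t *\<^sub>R q t)) \<in> borel_measurable borel"
    by measurable
  moreover have "indicator {0..T} t *\<^sub>R (indicator {0..} t *\<^sub>R q t) = indicator {0..T} t *\<^sub>R q t" for t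
    by (simp add: indicator_def)
  ultimately have "(\<lambda>t. indicator {0..T} t *\<^sub>R q t) \<in> borel_measurable borel"
    by (simp only:)
  then have meas: "set_borel_measurable lborel {0..T} q"
    by (simp add: set_borel_measurable_def)
  have "\<bar>q t\<bar> \<le> \<bar>K\<bar>" if "0 \<le> t" for t
    using K[of "q t"] assms that by (force simp: admissible_def)
  then show ?thesis
    by (intro set_integrable_bound[OF set_integrable_const_Icc meas]) auto
qed

text \<open>
  The bound is proved on a finite horizon because \<open>\<alpha>\<close> is only locally integrable, so
  \<open>exp (- \<beta> t) (\<alpha> t - q t)\<close> may fail to be integrable on the half-line.
\<close>

lemma finite_horizon_profit_le:
  assumes adm: "(\<alpha>, q) \<in> admissible A Q x" and "0 \<le> \<eta>" and "0 \<le> T"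
    and int: "set_integrable lborel {0..T} (\<lambda>t. exp (- \<beta> * t) * (R (q t) - C (\<alpha> t)))"
  shows "(LINT t:{0..T}|lborel. exp (- \<beta> * t) * (R (q t) - C (\<alpha> t)))
    \<le> H \<eta> * ((1 - exp (- \<beta> * T)) / \<beta>) + \<eta> * x"
proof -
  let ?e = "\<lambda>t. exp (- \<beta> * t)" and ?f = "\<lambda>t. \<alpha> t - q t"
  have f_int: "set_integrable lborel {0..t} ?f" if "0 \<le> t" for t
    using adm that set_integrable_sales[OF adm that] by (intro set_integral_diff) (auto simp: admissible_def)
  have inv: "- x \<le> integral {0..t} ?f" if "0 \<le> t" for t
    using adm that set_borel_integral_eq_integral(2)[OF f_int[OF that]]
    by (fastforce simp: admissible_def inventory_def)
  have flow: "- x \<le> integral {0..T} (\<lambda>t. ?e t * ?f t)"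
    using \<open>0 \<le> T\<close> \<beta>_pos inv set_borel_integral_eq_integral(1)[OF f_int[OF \<open>0 \<le> T\<close>]]
    by (intro discounted_flow_ge) auto
  have e_hi: "(?e has_integral (1 - exp (- \<beta> * T)) / \<beta>) {0..T}"
  proof -
    have "(?e has_integral (- exp (- \<beta> * T) / \<beta> - (- exp (- \<beta> * 0) / \<beta>))) {0..T}"
      using \<open>0 \<le> T\<close> \<beta>_pos
      by (intro fundamental_theorem_of_calculus)
         (auto intro!: derivative_eq_intros simp flip: has_real_derivative_iff_has_vector_derivative)
    then show ?thesis by (simp add: diff_divide_distrib)
  qed
  have ef_int: "(\<lambda>t. ?e t * ?f t) integrable_on {0..T}"
  proof -
    have "set_borel_measurable lborel {0..T} (\<lambda>t. ?e t * ?f t)"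
    proof -
      have "(\<lambda>t. indicator {0..T} t *\<^sub>R ?f t) \<in> borel_measurable lborel"
        using f_int[OF \<open>0 \<le> T\<close>] unfolding set_integrable_def by (rule borel_measurable_integrable)
      then have "(\<lambda>t. ?e t * (indicator {0..T} t *\<^sub>R ?f t)) \<in> borel_measurable lborel"
        by measurable
      then show ?thesis by (simp add: set_borel_measurable_def mult.left_commute)
    qed
    moreover have "norm (?e t * ?f t) \<le> norm (?f t)" if "t \<in> {0..T}" for t
      using that \<beta>_pos by (auto simp: abs_mult intro!: mult_left_le_one_le)
    ultimately have "set_integrable lborel {0..T} (\<lambda>t. ?e t * ?f t)"
      by (intro set_integrable_bound[OF f_int[OF \<open>0 \<le> T\<close>]]) auto
    then show ?thesis by (rule set_borel_integral_eq_integral)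
  qed
  have bound: "((\<lambda>t. H \<eta> * ?e t - \<eta> * (?e t * ?f t)) has_integral
      H \<eta> * ((1 - exp (- \<beta> * T)) / \<beta>) - \<eta> * integral {0..T} (\<lambda>t. ?e t * ?f t)) {0..T}"
    by (intro has_integral_diff has_integral_mult_right e_hi integrable_integral ef_int)
  have "integral {0..T} (\<lambda>t. ?e t * (R (q t) - C (\<alpha> t)))
      \<le> H \<eta> * ((1 - exp (- \<beta> * T)) / \<beta>) - \<eta> * integral {0..T} (\<lambda>t. ?e t * ?f t)"
  proof (rule has_integral_le[OF integrable_integral bound])
    show "(\<lambda>t. ?e t * (R (q t) - C (\<alpha> t))) integrable_on {0..T}"
      using int by (rule set_borel_integral_eq_integral)
    fix t assume "t \<in> {0..T}"
    then have "R (q t) - C (\<alpha> t) \<le> H \<eta> - \<eta> * ?f t"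
      using adm hamiltonian_ge[of "q t" "\<alpha> t" \<eta>] by (auto simp: admissible_def algebra_simps)
    then have "?e t * (R (q t) - C (\<alpha> t)) \<le> ?e t * (H \<eta> - \<eta> * ?f t)"
      by (intro mult_left_mono) auto
    then show "?e t * (R (q t) - C (\<alpha> t)) \<le> H \<eta> * ?e t - \<eta> * (?e t * ?f t)"
      by (simp add: algebra_simps)
  qed
  also have "\<dots> \<le> H \<eta> * ((1 - exp (- \<beta> * T)) / \<beta>) + \<eta> * x"
    using mult_left_mono[OF flow \<open>0 \<le> \<eta>\<close>] by simp
  finally show ?thesis
    by (simp only: set_borel_integral_eq_integral(2)[OF int])
qed

text \<open>
  Weak duality for dynamic strategies: the price \<open>\<eta>\<close> values the initial inventory at \<open>\<eta> x\<close>, and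
  \<open>H \<eta>\<close> bounds the profit rate that includes trade at this price.
\<close>

lemma payoff_le_hamiltonian:
  assumes adm: "(\<alpha>, q) \<in> admissible A Q x" and "0 \<le> \<eta>"
  shows "payoff R C \<beta> \<alpha> q \<le> ereal (H \<eta> / \<beta> + \<eta> * x)"
proof -
  let ?g = "\<lambda>t. exp (- \<beta> * t) * (R (q t) - C (\<alpha> t))"
  obtain K where K: "\<And>y. y \<in> Q \<Longrightarrow> R y \<le> K"
    using bdd_above_sales[of 0] by (auto simp: bdd_above_def)
  show ?thesis
    unfolding payoff_def
  proof (rule ext_integral_le[OF set_borel_measurable_profit[OF adm]])
    show "set_integrable lborel {0..} (\<lambda>t. K * exp (- \<beta> * t))"
      using set_integrable_discount[OF \<beta>_pos] by simp
    show "?g t \<le> K * exp (- \<beta> * t)" if "t \<in> {0..}" for t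
    proof -
      have "R (q t) - C (\<alpha> t) \<le> K"
        using K[of "q t"] C_nonneg adm that by (force simp: admissible_def)
      then show ?thesis by (simp add: mult.commute)
    qed
    assume int: "set_integrable lborel {0..} ?g"
    have lim: "(\<lambda>n. LINT t:{0..real n}|lborel. ?g t) \<longlonglongrightarrow> (LINT t:{0..}|lborel. ?g t)"
    proof -
      have U: "(\<Union>n. {0..real n}) = {0..}"
        using real_arch_simple by auto
      have "(\<lambda>n. LINT t:{0..real n}|lborel. ?g t) \<longlonglongrightarrow> (LINT t:(\<Union>n. {0..real n})|lborel. ?g t)"
        by (rule set_integral_cont_up) (use int U in \<open>auto simp: incseq_def\<close>)
      then show ?thesis by (simp only: U)
    qed
    have bound: "(LINT t:{0..real n}|lborel. ?g t)
        \<le> H \<eta> * ((1 - exp (- \<beta> * real n)) / \<beta>) + \<eta> * x" for n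
      using assms set_integrable_subset[OF int, of "{0..real n}"]
      by (intro finite_horizon_profit_le) auto
    have "(\<lambda>n. exp (- \<beta> * real n)) \<longlonglongrightarrow> 0"
      using \<beta>_pos by (intro filterlim_compose[OF exp_at_bot]
        filterlim_tendsto_neg_mult_at_bot[OF tendsto_const] filterlim_real_sequentially) auto
    then have "(\<lambda>n. H \<eta> * ((1 - exp (- \<beta> * real n)) / \<beta>) + \<eta> * x)
        \<longlonglongrightarrow> H \<eta> * ((1 - 0) / \<beta>) + \<eta> * x"
      using \<beta>_pos by (intro tendsto_intros) auto
    then have "(LINT t:{0..}|lborel. ?g t) \<le> H \<eta> * ((1 - 0) / \<beta>) + \<eta> * x"
      using bound by (intro LIMSEQ_le[OF lim]) auto
    then show "(LINT t:{0..}|lborel. ?g t) \<le> H \<eta> / \<beta> + \<eta> * x" by simp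
  qed
qed

section \<open>Two-phase deviations from a static strategy\<close>

definition two_phase :: "real \<Rightarrow> real \<Rightarrow> real \<Rightarrow> real \<Rightarrow> real \<Rightarrow> real \<Rightarrow> real" where
  "two_phase s r a b u t = (if t < s then a else if t < r then b else u)"

text \<open>
  Inventory and payoff of a two-phase strategy are integrals of such a \<open>g\<close> along the pair of rates.
  Writing it as a sum of jumps at the switching times leaves only integrals of \<open>indicator {s..}\<close>.
\<close>

lemma two_phase_eq:
  fixes g :: "real \<Rightarrow> real \<Rightarrow> real"
  assumes "s \<le> r"
  shows "g (two_phase s r a b u t) (two_phase s r a' b' u' t) =
    g a a' + (g b b' - g a a') * indicator {s..} t + (g u u' - g b b') * indicator {r..} t"
  using assms by (auto simp: two_phase_def indicator_def)

lemma
  fixes s t :: real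
  assumes "0 \<le> s" "0 \<le> t"
  shows set_integrable_after: "set_integrable lborel {0..t} (indicator {s..} :: real \<Rightarrow> real)"
    and set_integral_after: "(LINT y:{0..t}|lborel. indicator {s..} y) = max 0 (t - s)"
proof -
  have eq: "indicator {0..t} y *\<^sub>R (indicator {s..} y :: real) = indicator {s..t} y" for y
    using assms by (auto simp: indicator_def)
  show "set_integrable lborel {0..t} (indicator {s..} :: real \<Rightarrow> real)"
    unfolding set_integrable_def eq by (intro integrable_real_indicator) (auto simp: emeasure_lborel_Icc_eq)
  show "(LINT y:{0..t}|lborel. indicator {s..} y) = max 0 (t - s)"
    unfolding set_lebesgue_integral_def eq by (simp add: max_def)
qed

lemma two_phase_inventory:
  assumes "0 \<le> s" "s \<le> r" "0 \<le> t"
  shows "inventory x (two_phase s r a b u) (two_phase s r a' b' u') t =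
    x + (a - a') * t + ((b - b') - (a - a')) * max 0 (t - s)
      + ((u - u') - (b - b')) * max 0 (t - r)"
proof -
  have "(LINT y:{0..t}|lborel. (a - a') + ((b - b') - (a - a')) * indicator {s..} y
        + ((u - u') - (b - b')) * indicator {r..} y) =
      (a - a') * t + ((b - b') - (a - a')) * max 0 (t - s)
        + ((u - u') - (b - b')) * max 0 (t - r)"
    using assms
    by (simp add: set_integrable_const_Icc set_integrable_after set_integral_after set_integral_const)
       (simp add: algebra_simps)
  then show ?thesis
    unfolding inventory_def two_phase_eq[OF assms(2), where g = "(-)"] by simp
qed

lemma two_phase_payoff:
  assumes "0 \<le> s" "s \<le> r"
  shows "payoff R C \<beta> (two_phase s r a b u) (two_phase s r a' b' u') =
    ereal (((R a' - C a) + ((R b' - C b) - (R a' - C a)) * exp (- \<beta> * s)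
      + ((R u' - C u) - (R b' - C b)) * exp (- \<beta> * r)) / \<beta>)"
proof -
  define p\<^sub>1 p\<^sub>2 c where "p\<^sub>1 = R a' - C a" and "p\<^sub>2 = R b' - C b" and "c = R u' - C u"
  let ?e = "\<lambda>t. exp (- \<beta> * t)"
  have eq: "?e t * (R (two_phase s r a' b' u' t) - C (two_phase s r a b u t)) =
      p\<^sub>1 * ?e t + (p\<^sub>2 - p\<^sub>1) * (?e t * indicator {s..} t) + (c - p\<^sub>2) * (?e t * indicator {r..} t)"
    for t
    unfolding two_phase_eq[OF assms(2), where g = "\<lambda>y z. R y - C z"] p\<^sub>1_def p\<^sub>2_def c_def
    by (simp add: algebra_simps)
  have e: "set_integrable lborel {0..} ?e" "(LINT t:{0..}|lborel. ?e t) = 1 / \<beta>"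
    using set_integrable_discount[OF \<beta>_pos, of 0] set_integral_discount[OF \<beta>_pos, of 0] by auto
  have es: "set_integrable lborel {0..} (\<lambda>t. ?e t * indicator {y..} t)"
    "(LINT t:{0..}|lborel. ?e t * indicator {y..} t) = exp (- \<beta> * y) / \<beta>" if "0 \<le> y" for y
    using set_integrable_delayed_discount[OF \<beta>_pos that]
      set_integral_delayed_discount[OF \<beta>_pos that] by auto
  have "0 \<le> r" using assms by simp
  note int = e(1) es(1)[OF \<open>0 \<le> s\<close>] es(1)[OF \<open>0 \<le> r\<close>]
    and val = e(2) es(2)[OF \<open>0 \<le> s\<close>] es(2)[OF \<open>0 \<le> r\<close>]
  have sum_int: "set_integrable lborel {0..} (\<lambda>t. p\<^sub>1 * ?e t + (p\<^sub>2 - p\<^sub>1) * (?e t * indicator {s..} t)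
      + (c - p\<^sub>2) * (?e t * indicator {r..} t))"
    by (intro set_integral_add(1) set_integrable_mult_right int)
  have "(LINT t:{0..}|lborel. p\<^sub>1 * ?e t + (p\<^sub>2 - p\<^sub>1) * (?e t * indicator {s..} t)
      + (c - p\<^sub>2) * (?e t * indicator {r..} t)) =
      p\<^sub>1 * (1 / \<beta>) + (p\<^sub>2 - p\<^sub>1) * (exp (- \<beta> * s) / \<beta>) + (c - p\<^sub>2) * (exp (- \<beta> * r) / \<beta>)"
    by (subst set_integral_add(2) set_integral_mult_right val
        | intro set_integral_add(1) set_integrable_mult_right int | rule refl)+
  then show ?thesis
    unfolding payoff_def eq ext_integral_set_integrable[OF sum_int]
    by (simp add: p\<^sub>1_def p\<^sub>2_def c_def add_divide_distrib)
qed

text \<open>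
  The inventory rises during the first phase and falls during the second. The balance condition
  makes it return to \<open>x\<close> at time \<open>r\<close>, so it never drops below \<open>x\<close>.
\<close>

lemma two_phase_admissible:
  assumes sr: "0 \<le> s" "s \<le> r" and "0 \<le> x"
    and mem: "a \<in> A" "b \<in> A" "u \<in> A" "a' \<in> Q" "b' \<in> Q" "u \<in> Q"
    and d: "a' \<le> a" "b \<le> b'" and bal: "(a - a') * s + (b - b') * (r - s) = 0"
  shows "(two_phase s r a b u, two_phase s r a' b' u) \<in> admissible A Q x"
proof -
  have meas: "two_phase s r y z w \<in> borel_measurable borel" for y z w
    unfolding two_phase_def by measurable
  have int: "set_integrable lborel {0..T} (two_phase s r a b u)" if "0 \<le> T" for T
  proof -
    have "two_phase s r a b u =
        (\<lambda>t. a + (b - a) * indicator {s..} t + (u - b) * indicator {r..} t)"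
      using two_phase_eq[OF sr(2), where g = "\<lambda>y z. y"] by auto
    then show ?thesis
      using sr that by (auto intro!: set_integral_add(1) set_integrable_mult_right set_integrable_const_Icc set_integrable_after)
  qed
  have "0 \<le> inventory x (two_phase s r a b u) (two_phase s r a' b' u) t" if "0 \<le> t" for t
  proof -
    \<comment> \<open>The contributions of the two phases, in terms of the time spent in each.\<close>
    have eq: "(a - a') * t + ((b - b') - (a - a')) * max 0 (t - s) + (- (b - b')) * max 0 (t - r)
        = (a - a') * min t s + (b - b') * (min t r - min t s)"
      by (auto simp: max_def min_def algebra_simps)
    have "0 \<le> (a - a') * min t s + (b - b') * (min t r - min t s)"
    proof (cases "t \<le> s")
      case True
      then show ?thesis using sr d that by simp
    next
      case False
      have "(b - b') * (r - s) \<le> (b - b') * (min t r - s)"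
        using d by (intro mult_left_mono_neg) auto
      with False bal show ?thesis by simp
    qed
    then show ?thesis
      using two_phase_inventory[OF sr that, of x a b u a' b' u] eq \<open>0 \<le> x\<close> by simp
  qed
  then show ?thesis
    using mem meas int
    by (auto simp: admissible_def two_phase_def intro!: measurable_restrict_space1)
qed

lemma static_admissible:
  assumes "u \<in> Q \<inter> A" "0 \<le> x"
  shows "((\<lambda>_. u), (\<lambda>_. u)) \<in> admissible A Q x"
proof -
  have "two_phase 0 0 u u u = (\<lambda>_. u)" by (auto simp: two_phase_def)
  then show ?thesis using two_phase_admissible[of 0 0 x u u u u u] assms by simp
qed

lemma static_payoff: "payoff R C \<beta> (\<lambda>_. u) (\<lambda>_. u) = ereal ((R u - C u) / \<beta>)"
proof -
  have "two_phase 0 0 u u u = (\<lambda>_. u)" by (auto simp: two_phase_def)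
  then show ?thesis using two_phase_payoff[of 0 0 u u u u u u] by simp
qed

lemma payoff_le_value_fun:
  "(\<alpha>, q) \<in> admissible A Q x \<Longrightarrow> payoff R C \<beta> \<alpha> q \<le> value_fun A Q R C \<beta> x"
  unfolding value_fun_def by (rule SUP_upper2) auto

text \<open>
  Phases of durations \<open>(b' - b) \<tau>\<close> and \<open>(a - a') \<tau>\<close> balance the inventory. The payoff \<open>F \<tau> / \<beta>\<close> of
  this deviation agrees with the static payoff at \<open>\<tau> = 0\<close>. If the claimed inequality failed, \<open>F\<close>
  would have a positive derivative at \<open>0\<close>, and short phases would beat the static strategy.
\<close>

lemma mixture_le_optimal_static_profit:
  assumes opt: "optimal_strategy A Q R C \<beta> 0 (\<lambda>_. u) (\<lambda>_. u)" and u: "u \<in> Q \<inter> A"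
    and mem: "a \<in> A" "b \<in> A" "a' \<in> Q" "b' \<in> Q" and d: "a' < a" "b < b'"
  shows "(R a' - C a) * (b' - b) + (R b' - C b) * (a - a')
    \<le> (R u - C u) * ((a - a') - (b - b'))"
proof (rule ccontr)
  define p\<^sub>1 p\<^sub>2 c where "p\<^sub>1 = R a' - C a" and "p\<^sub>2 = R b' - C b" and "c = R u - C u"
  define F where "F \<tau> = p\<^sub>1 + (p\<^sub>2 - p\<^sub>1) * exp (- \<beta> * ((b' - b) * \<tau>))
      + (c - p\<^sub>2) * exp (- \<beta> * (((b' - b) + (a - a')) * \<tau>))" for \<tau>
  have le: "F \<tau> \<le> c" if "0 < \<tau>" for \<tau>
  proof -
    let ?s = "(b' - b) * \<tau>" and ?r = "((b' - b) + (a - a')) * \<tau>"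
    have sr: "0 \<le> ?s" "?s \<le> ?r" using that d by (auto intro!: mult_right_mono)
    have "(two_phase ?s ?r a b u, two_phase ?s ?r a' b' u) \<in> admissible A Q 0"
      using mem u d by (intro two_phase_admissible sr) (auto simp: algebra_simps)
    then have "ereal (F \<tau> / \<beta>) \<le> ereal (c / \<beta>)"
      using payoff_le_value_fun opt two_phase_payoff[OF sr, of a b u a' b' u]
      by (fastforce simp: optimal_strategy_def static_payoff F_def p\<^sub>1_def p\<^sub>2_def c_def)
    then show ?thesis using \<beta>_pos by (simp add: divide_le_cancel)
  qed
  assume "\<not> ?thesis"
  then have "0 < (p\<^sub>1 - p\<^sub>2) * (b' - b) + (p\<^sub>2 - c) * ((b' - b) + (a - a'))"
    by (simp add: p\<^sub>1_def p\<^sub>2_def c_def algebra_simps)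
  then have slope: "0 < \<beta> * ((p\<^sub>1 - p\<^sub>2) * (b' - b) + (p\<^sub>2 - c) * ((b' - b) + (a - a')))"
    using \<beta>_pos by simp
  have "(F has_real_derivative
      \<beta> * ((p\<^sub>1 - p\<^sub>2) * (b' - b) + (p\<^sub>2 - c) * ((b' - b) + (a - a')))) (at 0)"
    unfolding F_def by (auto intro!: derivative_eq_intros simp: algebra_simps)
  from DERIV_pos_inc_right[OF this slope]
  obtain \<epsilon> where "0 < \<epsilon>" and inc: "\<And>h. 0 < h \<Longrightarrow> h < \<epsilon> \<Longrightarrow> F 0 < F (0 + h)"
    by blast
  have "F 0 < F (\<epsilon> / 2)" using inc[of "\<epsilon> / 2"] \<open>0 < \<epsilon>\<close> by simp
  moreover have "F 0 = c" by (simp add: F_def)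
  ultimately show False using le[of "\<epsilon> / 2"] \<open>0 < \<epsilon>\<close> by simp
qed

section \<open>Optimal static strategies\<close>

lemma M_eta_imp_optimal:
  assumes "u \<in> M_eta A Q R C \<eta>"
  shows "optimal_strategy A Q R C \<beta> 0 (\<lambda>_. u) (\<lambda>_. u)"
proof -
  have u: "u \<in> Q \<inter> A" "H \<eta> \<le> R u - C u"
    using assms M_eta_iff by auto
  have "0 \<le> \<eta>"
    using assms M_eta_imp_min_point min_point_nonneg by blast
  have "value_fun A Q R C \<beta> 0 \<le> ereal ((R u - C u) / \<beta>)"
    unfolding value_fun_def
  proof (rule SUP_least, clarify)
    fix \<alpha> q assume "(\<alpha>, q) \<in> admissible A Q 0"
    then have "payoff R C \<beta> \<alpha> q \<le> ereal (H \<eta> / \<beta> + \<eta> * 0)"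
      using \<open>0 \<le> \<eta>\<close> by (intro payoff_le_hamiltonian) auto
    also have "\<dots> \<le> ereal ((R u - C u) / \<beta>)"
      using u(2) \<beta>_pos by (simp add: divide_right_mono)
    finally show "payoff R C \<beta> \<alpha> q \<le> ereal ((R u - C u) / \<beta>)" .
  qed
  moreover have adm: "((\<lambda>_. u), (\<lambda>_. u)) \<in> admissible A Q 0"
    using u(1) by (intro static_admissible) auto
  have "ereal ((R u - C u) / \<beta>) \<le> value_fun A Q R C \<beta> 0"
    using payoff_le_value_fun[OF adm] by (simp only: static_payoff)
  ultimately show ?thesis
    using adm by (simp add: optimal_strategy_def static_payoff antisym)
qed

lemma optimal_imp_M_eta:
  assumes u: "u \<in> M_static A Q R C"
    and opt: "optimal_strategy A Q R C \<beta> 0 (\<lambda>_. u) (\<lambda>_. u)"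
  obtains \<eta> where "u \<in> M_eta A Q R C \<eta>"
proof -
  have uQA: "u \<in> Q \<inter> A" and u_max: "\<And>w. w \<in> Q \<inter> A \<Longrightarrow> R w - C w \<le> R u - C u"
    using u by (auto simp: M_static_def argmax_set_def is_arg_max_linorder)
  \<comment> \<open>Net production and profit of all pairs of rates. The pairs \<open>(\<alpha>, 0)\<close> and \<open>(0, q)\<close> provide points
    on both sides of the vertical axis.\<close>
  define D where "D = (\<lambda>(\<alpha>, q). (\<alpha> - q, R q - C \<alpha>)) ` (A \<times> Q)"
  obtain \<alpha>\<^sub>0 where \<alpha>\<^sub>0: "\<alpha>\<^sub>0 \<in> A" "0 < \<alpha>\<^sub>0" using A_nontrivial A_nonneg by force
  obtain q\<^sub>0 where q\<^sub>0: "q\<^sub>0 \<in> Q" "0 < q\<^sub>0" using Q_nontrivial Q_nonneg by force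
  obtain \<eta> where \<eta>: "\<And>d p. (d, p) \<in> D \<Longrightarrow> p + \<eta> * d \<le> R u - C u"
  proof (rule exists_supporting_slope)
    show "(\<alpha>\<^sub>0, R 0 - C \<alpha>\<^sub>0) \<in> D" "(- q\<^sub>0, R q\<^sub>0 - C 0) \<in> D"
      using \<alpha>\<^sub>0 q\<^sub>0 zero_in_A zero_in_Q by (force simp: D_def)+
    show "0 < \<alpha>\<^sub>0" "- q\<^sub>0 < 0" using \<alpha>\<^sub>0 q\<^sub>0 by auto
    show "p * (- e) + r * d \<le> (R u - C u) * (d - e)"
      if "(d, p) \<in> D" "0 < d" "(e, r) \<in> D" "e < 0" for d p e r
    proof -
      obtain a a' b b' where "a \<in> A" "a' \<in> Q" "b \<in> A" "b' \<in> Q"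
        and eq: "d = a - a'" "p = R a' - C a" "e = b - b'" "r = R b' - C b"
        using \<open>(d, p) \<in> D\<close> \<open>(e, r) \<in> D\<close> by (auto simp: D_def)
      then show ?thesis
        using mixture_le_optimal_static_profit[OF opt uQA, of a b a' b'] that
        by simp
    qed
    show "p \<le> R u - C u" if "(0, p) \<in> D" for p
      using that u_max by (auto simp: D_def)
  qed blast
  have "R q - q * \<eta> + (\<alpha> * \<eta> - C \<alpha>) \<le> R u - C u" if "q \<in> Q" "\<alpha> \<in> A" for q \<alpha>
    using \<eta>[of "\<alpha> - q" "R q - C \<alpha>"] that by (force simp: D_def algebra_simps)
  then have "u \<in> M_eta A Q R C \<eta>"
    using uQA by (simp add: M_eta_iff hamiltonian_le_iff)
  then show ?thesis using that by blast
qed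

end

theorem theorem3:
  fixes A Q :: "real set" and R C :: "real \<Rightarrow> real" and \<beta> :: real
  assumes "A \<subseteq> {0..}" and "closed A" and "0 \<in> A" and "A - {0} \<noteq> {}"
    and "Q \<subseteq> {0..}" and "compact Q" and "0 \<in> Q" and "Q - {0} \<noteq> {}"
    and "continuous_on Q R" and "\<forall>q\<in>Q. 0 \<le> R q" and "R 0 = 0"
    and "continuous_on A C" and "\<forall>\<alpha>\<in>A. 0 \<le> C \<alpha>" and "mono_on A C"
    and "\<not> bounded A \<Longrightarrow> filterlim (\<lambda>\<alpha>. C \<alpha> / \<alpha>) at_top (inf at_top (principal A))"
    and "0 < \<beta>"
  shows "((\<exists>u \<in> M_static A Q R C. optimal_strategy A Q R C \<beta> 0 (\<lambda>_. u) (\<lambda>_. u))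
            \<longleftrightarrow> (\<exists>\<eta>. M_eta A Q R C \<eta> \<noteq> {}))
       \<and> ((\<exists>\<eta>. M_eta A Q R C \<eta> \<noteq> {}) \<longleftrightarrow> M_eta A Q R C (least_min_point A Q R C) \<noteq> {})
       \<and> (\<forall>\<eta>. M_eta A Q R C \<eta> \<noteq> {} \<longrightarrow>
            \<eta> \<in> min_points (hamiltonian A Q R C) \<and> M_eta A Q R C \<eta> = M_static A Q R C)"
proof -
  interpret discounted_production_model A Q R C \<beta>
    by unfold_locales (fact assms)+
  have "(\<exists>u \<in> M_static A Q R C. optimal_strategy A Q R C \<beta> 0 (\<lambda>_. u) (\<lambda>_. u))
      \<longleftrightarrow> (\<exists>\<eta>. M_eta A Q R C \<eta> \<noteq> {})"
    using optimal_imp_M_eta M_eta_imp_optimal M_eta_eq_M_static by (metis ex_in_conv)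
  then show ?thesis
    using M_eta_at_least_min_point M_eta_imp_min_point M_eta_eq_M_static by blast
qed

end
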